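(* Let $C_1,C_2,C_3,C_4\in\mathbb{R}$ and consider the system of differential equations $$\begin{cases} \dot a_{11}=a_{12}\big((C_4-C_1)a_{11}a_{21}+C_2a_{11}^2-C_3a_{21}^2\big),\\ \dot a_{12}=a_{11}\big((C_1-C_4)a_{12}a_{22}-C_2a_{12}^2+C_3a_{22}^2\big),\\ \dot a_{21}=a_{22}\big((C_4-C_1)a_{11}a_{21}+C_2a_{11}^2-C_3a_{21}^2\big),\\ \dot a_{22}=a_{21}\big((C_1-C_4)a_{12}a_{22}-C_2a_{12}^2+C_3a_{22}^2\big), \end{cases}$$ with initial condition $a_{11}(0)=a_{22}(0)=1$, $a_{12}(0)=a_{21}(0)=0$. (i) If $C_1=C_4$ and $C_2=C_3=C\neq0$, the solution is $$\begin{pmatrix}a_{11}(t)&a_{12}(t)\\ a_{21}(t)&a_{22}(t)\end{pmatrix}=\begin{pmatrix}\cosh(Ct)&\sinh(Ct)\\ \sinh(Ct)&\cosh(Ct)\end{pmatrix}.$$ (ii) If $C_1=C_4$ and $C_2=-C_3=C\neq0$, the solution is $$\begin{pmatrix}a_{11}(t)&a_{12}(t)\\ a_{21}(t)&a_{22}(t)\end{pmatrix}=\begin{pmatrix}\cos(Ct)&-\sin(Ct)\\ \sin(Ct)&\cos(Ct)\end{pmatrix}.$$ (iii) If $C_2=C_3=0$, the only solution is the constant one, $a_{11}(t)=a_{22}(t)=1$, $a_{12}(t)=a_{21}(t)=0$.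
   Context: The system describes the trajectories in $\mathrm{SL}(2,\mathbb{R})$ of the metric quadratic Hamiltonian on $T^*\mathrm{SL}(2,\mathbb{R})$ with fixed values $C_1,\dots,C_4$ of conserved quantities; no further notation is needed. *)

theory Defs
  imports "HOL-Analysis.Analysis"
begin

text \<open>
  The entry \<open>A t $ i $ j\<close> is the component function \<open>a\<^sub>i\<^sub>j\<close> at time \<open>t\<close>. A solution lives on an
  arbitrary interval \<open>J\<close> containing the initial time 0, with derivatives taken within \<open>J\<close>,
  hence one-sided at endpoints belonging to \<open>J\<close>.
\<close>

definition is_solution_on ::
  "real \<Rightarrow> real \<Rightarrow> real \<Rightarrow> real \<Rightarrow> real set \<Rightarrow> (real \<Rightarrow> real^2^2) \<Rightarrow> bool" where
  "is_solution_on C1 C2 C3 C4 J A \<longleftrightarrow>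
     is_interval J \<and> 0 \<in> J \<and>
     A 0 $ 1 $ 1 = 1 \<and> A 0 $ 2 $ 2 = 1 \<and> A 0 $ 1 $ 2 = 0 \<and> A 0 $ 2 $ 1 = 0 \<and>
     (\<forall>t\<in>J.
       let a11 = A t $ 1 $ 1; a12 = A t $ 1 $ 2; a21 = A t $ 2 $ 1; a22 = A t $ 2 $ 2 in
       ((\<lambda>s. A s $ 1 $ 1) has_real_derivative
          a12 * ((C4 - C1) * a11 * a21 + C2 * a11\<^sup>2 - C3 * a21\<^sup>2)) (at t within J) \<and>
       ((\<lambda>s. A s $ 1 $ 2) has_real_derivative
          a11 * ((C1 - C4) * a12 * a22 - C2 * a12\<^sup>2 + C3 * a22\<^sup>2)) (at t within J) \<and>
       ((\<lambda>s. A s $ 2 $ 1) has_real_derivative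
          a22 * ((C4 - C1) * a11 * a21 + C2 * a11\<^sup>2 - C3 * a21\<^sup>2)) (at t within J) \<and>
       ((\<lambda>s. A s $ 2 $ 2) has_real_derivative
          a21 * ((C1 - C4) * a12 * a22 - C2 * a12\<^sup>2 + C3 * a22\<^sup>2)) (at t within J))"

text \<open>
  ``The solution is \<open>A\<close>'': \<open>A\<close> is a solution on the whole real line, and every solution on any
  interval containing 0 is a restriction of \<open>A\<close>.
\<close>

definition is_the_solution ::
  "real \<Rightarrow> real \<Rightarrow> real \<Rightarrow> real \<Rightarrow> (real \<Rightarrow> real^2^2) \<Rightarrow> bool" where
  "is_the_solution C1 C2 C3 C4 A \<longleftrightarrow>
     is_solution_on C1 C2 C3 C4 UNIV A \<and>
     (\<forall>J B. is_solution_on C1 C2 C3 C4 J B \<longrightarrow> (\<forall>t\<in>J. B t = A t))"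

end

(* Write q for the quadratic form q(v) = (C4 - C1) v1 v2 + C2 v1^2 - C3 v2^2, and x, y for the two
   columns of A. The system reads x' = q(x) y, y' = - q(y) x. Twice the polar form of q at (x, y) is
   conserved, so it keeps its initial value C4 - C1, and q(x), q(y) satisfy scalar linear equations
   with explicit solutions. Hence every solution satisfies one and the same linear system
   x' = P(t) y, y' = Q(t) x. As that system is traceless, the products of one solution with the
   adjugate of another are constant, which gives uniqueness. *)

theory Submission
  imports Defs
begin

lemma constant_on_interval:
  fixes f :: "real \<Rightarrow> real"
  assumes "is_interval J" "0 \<in> J"
    and "\<And>t. t \<in> J \<Longrightarrow> (f has_real_derivative 0) (at t within J)"
    and "t \<in> J"
  shows "f t = f 0"
  using has_field_derivative_zero_constant[of J f] assms
  by (metis is_interval_convex_1)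

lemma linear_scalar_ode_unique:
  fixes f :: "real \<Rightarrow> real"
  assumes "is_interval J" "0 \<in> J"
    and D: "\<And>t. t \<in> J \<Longrightarrow> (f has_real_derivative k * f t) (at t within J)"
    and "t \<in> J"
  shows "f t = f 0 * exp (k * t)"
proof -
  have "f t * exp (- (k * t)) = f 0 * exp (- (k * 0))"
    using assms(1,2) _ \<open>t \<in> J\<close>
  proof (rule constant_on_interval)
    fix s assume "s \<in> J"
    show "((\<lambda>s. f s * exp (- (k * s))) has_real_derivative 0) (at s within J)"
      by (rule derivative_eq_intros D \<open>s \<in> J\<close> refl | simp)+
  qed
  then show ?thesis
    by (simp add: exp_minus field_simps)
qed

text \<open>The pair \<open>(u, v)\<close> stands for one row of the matrix. Both rows obey the same
  scalar system, whose coefficient matrix has zero diagonal and off-diagonal entries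
  \<open>P\<close>, \<open>Q\<close>.\<close>

definition is_linear_solution_on ::
  "real set \<Rightarrow> (real \<Rightarrow> real) \<Rightarrow> (real \<Rightarrow> real) \<Rightarrow> (real \<Rightarrow> real) \<Rightarrow> (real \<Rightarrow> real) \<Rightarrow> bool" where
  "is_linear_solution_on J P Q u v \<longleftrightarrow>
     (\<forall>t\<in>J. (u has_real_derivative P t * v t) (at t within J) \<and>
            (v has_real_derivative Q t * u t) (at t within J))"

text \<open>Differentiating the determinant with rows \<open>(u, v)\<close> and
  \<open>(x, y)\<close>, the terms \<open>P v y\<close> and \<open>Q u x\<close> each occur twice
  with opposite signs.\<close>

lemma wronskian_constant:
  assumes "is_interval J" "0 \<in> J"
    and uv: "is_linear_solution_on J P Q u v"
    and xy: "is_linear_solution_on J P Q x y"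
    and "t \<in> J"
  shows "u t * y t - v t * x t = u 0 * y 0 - v 0 * x 0"
  using assms(1,2) _ \<open>t \<in> J\<close>
proof (rule constant_on_interval)
  fix s assume s: "s \<in> J"
  have D: "(u has_real_derivative P s * v s) (at s within J)"
    "(v has_real_derivative Q s * u s) (at s within J)"
    "(x has_real_derivative P s * y s) (at s within J)"
    "(y has_real_derivative Q s * x s) (at s within J)"
    using uv xy s by (auto simp: is_linear_solution_on_def)
  show "((\<lambda>s. u s * y s - v s * x s) has_real_derivative 0) (at s within J)"
    by (rule derivative_eq_intros D refl | simp add: algebra_simps)+
qed

text \<open>The cubic factors turn out to be functions of time alone, the same for all solutions.
  The constants \<open>C2\<close> and \<open>C3\<close> in \<open>P\<close> and \<open>Q\<close> are
  their values at the identity matrix.\<close>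

lemma is_solution_on_imp_linear:
  assumes sol: "is_solution_on C1 C2 C3 C4 J A"
  defines "P \<equiv> \<lambda>t. C2 * exp ((C4 - C1) * t)"
    and "Q \<equiv> \<lambda>t. C3 * exp ((C1 - C4) * t)"
  shows "is_linear_solution_on J P Q (\<lambda>t. A t $ 1 $ 1) (\<lambda>t. A t $ 1 $ 2)"
    and "is_linear_solution_on J P Q (\<lambda>t. A t $ 2 $ 1) (\<lambda>t. A t $ 2 $ 2)"
proof -
  define a b c d where "a = (\<lambda>t. A t $ 1 $ 1)" and "b = (\<lambda>t. A t $ 1 $ 2)"
    and "c = (\<lambda>t. A t $ 2 $ 1)" and "d = (\<lambda>t. A t $ 2 $ 2)"
  note abcd = a_def b_def c_def d_def
  \<comment> \<open>With columns x = (\<open>a\<close>, \<open>c\<close>) and y = (\<open>b\<close>,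
    \<open>d\<close>), \<open>p\<close> is the quadratic form at x, \<open>q\<close> is minus the
    form at y, and \<open>r\<close> is twice the polar form at (x, y). Thus x' = p y and y' = q x,
    so r' = 2 p (- q) + 2 q p = 0.\<close>
  define p where "p = (\<lambda>t. (C4 - C1) * a t * c t + C2 * (a t)\<^sup>2 - C3 * (c t)\<^sup>2)"
  define q where "q = (\<lambda>t. (C1 - C4) * b t * d t - C2 * (b t)\<^sup>2 + C3 * (d t)\<^sup>2)"
  define r where
    "r = (\<lambda>t. (C4 - C1) * (a t * d t + b t * c t) + 2 * C2 * a t * b t - 2 * C3 * c t * d t)"
  have J: "is_interval J" "0 \<in> J"
    and init: "a 0 = 1" "b 0 = 0" "c 0 = 0" "d 0 = 1"
    using sol by (auto simp: is_solution_on_def abcd)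
  have D: "(a has_real_derivative b t * p t) (at t within J)"
    "(b has_real_derivative a t * q t) (at t within J)"
    "(c has_real_derivative d t * p t) (at t within J)"
    "(d has_real_derivative c t * q t) (at t within J)" if "t \<in> J" for t
    using sol that by (auto simp: is_solution_on_def abcd p_def q_def Let_def)
  have r: "r t = C4 - C1" if "t \<in> J" for t
  proof -
    have "r t = r 0"
      using J _ that
    proof (rule constant_on_interval)
      fix s assume "s \<in> J"
      show "(r has_real_derivative 0) (at s within J)"
        unfolding r_def
        by (rule derivative_eq_intros D \<open>s \<in> J\<close> refl)+
          (simp add: p_def q_def algebra_simps power2_eq_square)
    qed
    then show ?thesis
      by (simp add: r_def init)
  qed
  \<comment> \<open>The derivative of the form at x is twice the polar form at (x, x'), and x' = p
    y. Since \<open>r\<close> is constant, this is a linear equation with constant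
    coefficient.\<close>
  have "(p has_real_derivative r t * p t) (at t within J)" if "t \<in> J" for t
    unfolding p_def r_def
    by (rule derivative_eq_intros D that refl)+
      (simp add: p_def algebra_simps power2_eq_square)
  then have p: "p t = P t" if "t \<in> J" for t
    using linear_scalar_ode_unique[OF J, of p "C4 - C1" t] r that
    by (simp add: p_def P_def init)
  have "(q has_real_derivative - r t * q t) (at t within J)" if "t \<in> J" for t
    unfolding q_def r_def
    by (rule derivative_eq_intros D that refl)+
      (simp add: q_def algebra_simps power2_eq_square)
  then have q: "q t = Q t" if "t \<in> J" for t
    using linear_scalar_ode_unique[OF J, of q "C1 - C4" t] r that
    by (simp add: q_def Q_def init)
  show "is_linear_solution_on J P Q (\<lambda>t. A t $ 1 $ 1) (\<lambda>t. A t $ 1 $ 2)"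
    "is_linear_solution_on J P Q (\<lambda>t. A t $ 2 $ 1) (\<lambda>t. A t $ 2 $ 2)"
    using D p q unfolding is_linear_solution_on_def abcd[symmetric]
    by (auto simp: mult.commute)
qed

lemma is_solution_on_unique:
  assumes A: "is_solution_on C1 C2 C3 C4 J A"
    and B: "is_solution_on C1 C2 C3 C4 J B"
    and t: "t \<in> J"
  shows "B t = A t"
proof -
  have J: "is_interval J" "0 \<in> J"
    and init: "A 0 $ 1 $ 1 = 1" "A 0 $ 2 $ 2 = 1" "A 0 $ 1 $ 2 = 0" "A 0 $ 2 $ 1 = 0"
      "B 0 $ 1 $ 1 = 1" "B 0 $ 2 $ 2 = 1" "B 0 $ 1 $ 2 = 0" "B 0 $ 2 $ 1 = 0"
    using A B by (auto simp: is_solution_on_def)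
  note W = wronskian_constant[OF J _ _ t]
  note LA = is_solution_on_imp_linear[OF A] and LB = is_solution_on_imp_linear[OF B]
  have det: "A t $ 1 $ 1 * A t $ 2 $ 2 - A t $ 1 $ 2 * A t $ 2 $ 1 = 1"
    using W[OF LA] by (simp add: init)
  \<comment> \<open>The labels pair a row of \<open>B\<close> with a row of \<open>A\<close>. Up to
    sign, the four facts are the entries of B adj(A) = I.\<close>
  have 11: "B t $ 1 $ 1 * A t $ 1 $ 2 - B t $ 1 $ 2 * A t $ 1 $ 1 = 0"
    using W[OF LB(1) LA(1)] by (simp add: init)
  have 12: "B t $ 1 $ 1 * A t $ 2 $ 2 - B t $ 1 $ 2 * A t $ 2 $ 1 = 1"
    using W[OF LB(1) LA(2)] by (simp add: init)
  have 21: "B t $ 2 $ 1 * A t $ 1 $ 2 - B t $ 2 $ 2 * A t $ 1 $ 1 = -1"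
    using W[OF LB(2) LA(1)] by (simp add: init)
  have 22: "B t $ 2 $ 1 * A t $ 2 $ 2 - B t $ 2 $ 2 * A t $ 2 $ 1 = 0"
    using W[OF LB(2) LA(2)] by (simp add: init)
  \<comment> \<open>Facts \<open>11\<close> and \<open>12\<close> form a linear system for the first
    row of \<open>B\<close> with determinant 1 up to sign, and the first row of \<open>A\<close>
    solves it too.\<close>
  have "B t $ 1 $ 1 = A t $ 1 $ 1" "B t $ 1 $ 2 = A t $ 1 $ 2"
    using det 11 12 by algebra+
  moreover have "B t $ 2 $ 1 = A t $ 2 $ 1" "B t $ 2 $ 2 = A t $ 2 $ 2"
    using det 21 22 by algebra+
  ultimately show ?thesis
    by (simp add: vec_eq_iff forall_2)
qed

lemma is_solution_on_subset:
  assumes "is_solution_on C1 C2 C3 C4 J A" "is_interval I" "0 \<in> I" "I \<subseteq> J"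
  shows "is_solution_on C1 C2 C3 C4 I A"
  using assms unfolding is_solution_on_def Let_def
  by (meson DERIV_subset subsetD)

text \<open>A global solution restricts to every interval containing 0, where uniqueness applies. It
  thus remains only to check the explicit formulas.\<close>

lemma is_the_solution_iff:
  "is_the_solution C1 C2 C3 C4 A \<longleftrightarrow> is_solution_on C1 C2 C3 C4 UNIV A"
proof
  assume A: "is_solution_on C1 C2 C3 C4 UNIV A"
  have "B t = A t" if B: "is_solution_on C1 C2 C3 C4 J B" and "t \<in> J" for J B t
  proof -
    have "is_solution_on C1 C2 C3 C4 J A"
      using A B by (intro is_solution_on_subset[OF A]) (auto simp: is_solution_on_def)
    then show ?thesis
      using is_solution_on_unique B \<open>t \<in> J\<close> by blast
  qed
  with A show "is_the_solution C1 C2 C3 C4 A"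
    by (auto simp: is_the_solution_def)
qed (simp add: is_the_solution_def)

lemma hyperbolic_solution:
  "is_solution_on C1 C C C1 UNIV
    (\<lambda>t. vector [vector [cosh (C * t), sinh (C * t)], vector [sinh (C * t), cosh (C * t)]])"
proof -
  \<comment> \<open>This makes both cubic factors collapse to the constant \<open>C\<close>.\<close>
  have [simp]: "C * (cosh x)\<^sup>2 = C + C * (sinh x)\<^sup>2" for x :: real
    by (simp add: cosh_square_eq algebra_simps)
  show ?thesis
    unfolding is_solution_on_def Let_def
    by (simp, intro allI conjI; (rule derivative_eq_intros refl | simp)+)
qed

lemma elliptic_solution:
  "is_solution_on C1 C (- C) C1 UNIV
    (\<lambda>t. vector [vector [cos (C * t), - sin (C * t)], vector [sin (C * t), cos (C * t)]])"
proof -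
  \<comment> \<open>Here the factors collapse to \<open>C\<close> and \<open>- C\<close>.\<close>
  have [simp]: "C * (cos x)\<^sup>2 = C - C * (sin x)\<^sup>2" for x :: real
    by (simp add: cos_squared_eq algebra_simps)
  show ?thesis
    unfolding is_solution_on_def Let_def
    by (simp, intro allI conjI; (rule derivative_eq_intros refl | simp)+)
qed

lemma constant_solution:
  "is_solution_on C1 0 0 C4 UNIV (\<lambda>t. vector [vector [1, 0], vector [0, 1]])"
  by (auto simp: is_solution_on_def)

theorem mainTheorem5:
  fixes C1 C2 C3 C4 :: real
  shows "(\<forall>C. C1 = C4 \<and> C2 = C \<and> C3 = C \<and> C \<noteq> 0 \<longrightarrow>
            is_the_solution C1 C2 C3 C4
              (\<lambda>t. vector [vector [cosh (C * t), sinh (C * t)],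
                           vector [sinh (C * t), cosh (C * t)]]))
       \<and> (\<forall>C. C1 = C4 \<and> C2 = C \<and> - C3 = C \<and> C \<noteq> 0 \<longrightarrow>
            is_the_solution C1 C2 C3 C4
              (\<lambda>t. vector [vector [cos (C * t), - sin (C * t)],
                           vector [sin (C * t), cos (C * t)]]))
       \<and> (C2 = 0 \<and> C3 = 0 \<longrightarrow>
            is_the_solution C1 C2 C3 C4
              (\<lambda>t. vector [vector [1, 0],
                           vector [0, 1]]))"
  unfolding is_the_solution_iff
proof (intro conjI allI impI)
  fix C assume "C1 = C4 \<and> C2 = C \<and> - C3 = C \<and> C \<noteq> 0"
  then have "C4 = C1" "C2 = C" "C3 = - C"
    by auto
  then show "is_solution_on C1 C2 C3 C4 UNIV
      (\<lambda>t. vector [vector [cos (C * t), - sin (C * t)], vector [sin (C * t), cos (C * t)]])"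
    using elliptic_solution by simp
qed (use hyperbolic_solution constant_solution in auto)

end
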